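(* Let $X$ be a reflexive Banach space, let $U\subset X$ be convex and bounded, and let $\varphi_1,\varphi_2\colon X\to\mathbb{R}_\infty$ be weakly sequentially lower semicontinuous on $U$, with $\operatorname{dom}\varphi_1\cap\operatorname{dom}\varphi_2\cap U\ne\emptyset$. Then the pair $(\varphi_1,\varphi_2)$ is quasiuniformly lower semicontinuous on $U$.
   Context: $\mathbb{R}_\infty:=\mathbb{R}\cup\{+\infty\}$, $\operatorname{dom}\varphi:=\{x\mid\varphi(x)<+\infty\}$, $\inf\emptyset=+\infty$. A set $V\subset X$ is an essentially interior subset of $U$ if $\bigcup_{x\in V}B_\rho(x)\subset U$ for some $\rho>0$ ($B_\rho$ = open ball); $EI(U)$ is the collection of all such $V$ (including $\emptyset$). Put $$\Lambda_U^\circ(\varphi_1,\varphi_2):=\lim_{\eta\downarrow0}\ \inf_{x_1,x_2\in U,\ \|x_1-x_2\|<\eta}(\varphi_1(x_1)+\varphi_2(x_2)),\qquad \Lambda_U^\dagger(\varphi_1,\varphi_2):=\inf_{V\in EI(U)}\Lambda_V^\circ(\varphi_1,\varphi_2).$$ The pair $(\varphi_1,\varphi_2)$ is quasiuniformly lower semicontinuous on $U$ if $\inf_U(\varphi_1+\varphi_2)\le\Lambda_U^\dagger(\varphi_1,\varphi_2)$. *)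

theory Defs
  imports "HOL-Analysis.Analysis"
begin

definition bidual_embedding :: "'a::real_normed_vector \<Rightarrow> ('a \<Rightarrow>\<^sub>L real) \<Rightarrow>\<^sub>L real"
  where "bidual_embedding x = Blinfun (\<lambda>f. blinfun_apply f x)"

lemma bidual_embedding_apply [simp]:
  "blinfun_apply (bidual_embedding x) f = blinfun_apply f x"
  unfolding bidual_embedding_def
  by (simp add: bounded_linear_Blinfun_apply blinfun.bounded_linear_left)

definition reflexive_space :: "'a::real_normed_vector itself \<Rightarrow> bool"
  where "reflexive_space _ \<longleftrightarrow>
    surj (bidual_embedding :: 'a \<Rightarrow> ('a \<Rightarrow>\<^sub>L real) \<Rightarrow>\<^sub>L real)"

definition weakly_converges :: "(nat \<Rightarrow> 'a::real_normed_vector) \<Rightarrow> 'a \<Rightarrow> bool"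
  where "weakly_converges u x \<longleftrightarrow>
    (\<forall>f :: 'a \<Rightarrow>\<^sub>L real. (\<lambda>n. blinfun_apply f (u n)) \<longlonglongrightarrow> blinfun_apply f x)"

text \<open>Lower semicontinuity on \<open>U\<close> is that of the restriction to \<open>U\<close>: the sequences as well
  as their limits lie in \<open>U\<close>.\<close>

definition weakly_seq_lsc_on :: "'a::real_normed_vector set \<Rightarrow> ('a \<Rightarrow> ereal) \<Rightarrow> bool"
  where "weakly_seq_lsc_on U \<phi> \<longleftrightarrow>
    (\<forall>x\<in>U. \<forall>u. (\<forall>n. u n \<in> U) \<and> weakly_converges u x \<longrightarrow> \<phi> x \<le> liminf (\<lambda>n. \<phi> (u n)))"

definition edom :: "('a \<Rightarrow> ereal) \<Rightarrow> 'a set"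
  where "edom \<phi> = {x. \<phi> x < \<infinity>}"

definition EI :: "'a::real_normed_vector set \<Rightarrow> 'a set set"
  where "EI U = {V. \<exists>\<rho>>0. (\<Union>x\<in>V. ball x \<rho>) \<subseteq> U}"

definition Lambda_circ ::
    "'a::real_normed_vector set \<Rightarrow> ('a \<Rightarrow> ereal) \<Rightarrow> ('a \<Rightarrow> ereal) \<Rightarrow> ereal"
  where "Lambda_circ U \<phi>1 \<phi>2 =
    Lim (at_right (0::real))
      (\<lambda>\<eta>. INF (x1, x2) \<in> {(x1, x2). x1 \<in> U \<and> x2 \<in> U \<and> norm (x1 - x2) < \<eta>}. \<phi>1 x1 + \<phi>2 x2)"

text \<open>The limit always exists, so \<^const>\<open>Lim\<close> is never an arbitrary value.\<close>

lemma Lambda_circ_tendsto: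
  fixes U :: "'a::real_normed_vector set"
  shows "((\<lambda>\<eta>. INF (x1, x2) \<in> {(x1, x2). x1 \<in> U \<and> x2 \<in> U \<and> norm (x1 - x2) < \<eta>}. \<phi>1 x1 + \<phi>2 x2)
      \<longlongrightarrow> Lambda_circ U \<phi>1 \<phi>2) (at_right 0)"
proof -
  define g :: "real \<Rightarrow> ereal" where
    "g = (\<lambda>\<eta>. INF (x1, x2) \<in> {(x1, x2). x1 \<in> U \<and> x2 \<in> U \<and> norm (x1 - x2) < \<eta>}. \<phi>1 x1 + \<phi>2 x2)"
  have anti: "g b \<le> g a" if "a \<le> b" for a b
    unfolding g_def using that by (intro INF_superset_mono) auto
  have "(g \<longlongrightarrow> (SUP \<eta>\<in>{0<..}. g \<eta>)) (at_right 0)"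
  proof (rule order_tendstoI)
    fix y assume "y < (SUP \<eta>\<in>{0<..}. g \<eta>)"
    then obtain b where b: "b > 0" "y < g b" by (auto simp: less_SUP_iff)
    show "eventually (\<lambda>\<eta>. y < g \<eta>) (at_right 0)"
      using eventually_at_right_less[of "0::real"] eventually_at_right_real[OF b(1)]
      by eventually_elim (use anti b in \<open>force intro: less_le_trans\<close>)
  next
    fix y assume y: "(SUP \<eta>\<in>{0<..}. g \<eta>) < y"
    show "eventually (\<lambda>\<eta>. g \<eta> < y) (at_right 0)"
      using eventually_at_right_less[of "0::real"]
      by eventually_elim (use y in \<open>auto intro: le_less_trans[OF SUP_upper]\<close>)
  qed
  then show ?thesis
    unfolding Lambda_circ_def g_def[symmetric] by (simp add: tendsto_Lim)
qed

definition Lambda_dagger ::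
    "'a::real_normed_vector set \<Rightarrow> ('a \<Rightarrow> ereal) \<Rightarrow> ('a \<Rightarrow> ereal) \<Rightarrow> ereal"
  where "Lambda_dagger U \<phi>1 \<phi>2 = (INF V \<in> EI U. Lambda_circ V \<phi>1 \<phi>2)"

definition quasiuniformly_lsc_on ::
    "'a::real_normed_vector set \<Rightarrow> ('a \<Rightarrow> ereal) \<Rightarrow> ('a \<Rightarrow> ereal) \<Rightarrow> bool"
  where "quasiuniformly_lsc_on U \<phi>1 \<phi>2 \<longleftrightarrow>
    (INF x \<in> U. \<phi>1 x + \<phi>2 x) \<le> Lambda_dagger U \<phi>1 \<phi>2"

end

theory Submission
  imports Defs
begin

text \<open>
  Let \<open>V\<close> be essentially interior to \<open>U\<close> and suppose the relaxed infimum over pairs in \<open>V\<close> lies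
  below \<open>c\<close>. There are \<open>a n\<close>, \<open>b n\<close> in \<open>V\<close> with \<open>a n - b n\<close> tending to \<open>0\<close> and
  \<open>\<phi>1 (a n) + \<phi>2 (b n) < c\<close>. In a reflexive space the bounded sequence \<open>a\<close> has a weakly convergent
  subsequence, and the corresponding \<open>b n\<close> converge weakly to the same point \<open>x\<close>. By Mazur's theorem
  \<open>x\<close> lies in the closed convex hull of \<open>V\<close>, which is contained in \<open>U\<close> because \<open>U\<close> is convex and
  leaves a uniform margin around \<open>V\<close>. Lower semicontinuity of both functions at \<open>x\<close> gives \<open>\<phi>1 x + \<phi>2 x \<le> c\<close>.

  The functional analysis behind this rests on one form of the Hahn--Banach theorem,
  \<open>Hahn_Banach_convex\<close>: a sublinear \<open>p\<close> that is at least \<open>d\<close> on a convex set dominates a linear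
  functional with the same lower bound on that set. Applied to the norm it separates points from
  convex sets. Applied on the dual space to the upper limit of \<open>f (u n)\<close> as a function of \<open>f\<close>, it
  produces an element of the bidual, hence by reflexivity a point \<open>x\<close> that is weakly adherent to
  \<open>u\<close> and for which a prescribed functional attains its upper limit along \<open>u\<close>. Therefore a bounded
  sequence with only one weakly adherent point converges weakly to it. Finally, all weakly adherent
  points of \<open>u\<close> lie in a separable closed subspace, whose points are separated by countably many
  functionals; a subsequence along which each of these converges has only one adherent point.
\<close>

section \<open>Sublinear functionals and the Hahn--Banach theorem\<close>

definition sublinear :: "('a::real_vector \<Rightarrow> real) \<Rightarrow> bool"
  where "sublinear p \<longleftrightarrow>
    (\<forall>x y. p (x + y) \<le> p x + p y) \<and> (\<forall>t x. 0 \<le> t \<longrightarrow> p (t *\<^sub>R x) = t * p x)"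

lemma sublinear_add: "sublinear p \<Longrightarrow> p (x + y) \<le> p x + p y"
  and sublinear_scale: "sublinear p \<Longrightarrow> 0 \<le> t \<Longrightarrow> p (t *\<^sub>R x) = t * p x"
  by (auto simp: sublinear_def)

lemma sublinear_zero: "sublinear p \<Longrightarrow> p 0 = 0"
  using sublinear_scale[of p 0 0] by simp

lemma sublinear_minus: "sublinear p \<Longrightarrow> - p (- x) \<le> p x"
  using sublinear_add[of p x "- x"] by (simp add: sublinear_zero)

lemma sublinearI:
  assumes "\<And>x y. p (x + y) \<le> p x + p y" "p 0 = 0"
    and "\<And>t x. 0 < t \<Longrightarrow> p (t *\<^sub>R x) \<le> t * p x"
  shows "sublinear p"
  unfolding sublinear_def
proof (intro conjI allI impI)
  fix t :: real and x assume "0 \<le> t"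
  show "p (t *\<^sub>R x) = t * p x"
  proof (cases "t = 0")
    case False
    with \<open>0 \<le> t\<close> have t: "0 < t" by simp
    have "p x \<le> inverse t * p (t *\<^sub>R x)"
      using assms(3)[of "inverse t" "t *\<^sub>R x"] t by simp
    then have "t * p x \<le> p (t *\<^sub>R x)"
      using t by (simp add: field_simps)
    with assms(3)[OF t] show ?thesis by (simp add: order_antisym)
  qed (simp add: assms)
qed (rule assms)

text \<open>
  The convex set is absorbed into the functional: \<open>q x\<close> is the infimum of \<open>p (x + t k) - t d\<close> over
  \<open>t \<ge> 0\<close> and \<open>k \<in> K\<close>. The lower bound \<open>d \<le> p k\<close> keeps this infimum finite, convexity of \<open>K\<close> makes
  it subadditive, and any linear functional below \<open>q\<close> is at least \<open>d\<close> on \<open>K\<close>, since it is at most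
  \<open>- d\<close> on \<open>- K\<close>.
\<close>

lemma sublinear_below_on_convex:
  assumes p: "sublinear p" and K: "convex K" "K \<noteq> {}" and d: "\<And>k. k \<in> K \<Longrightarrow> d \<le> p k"
  shows "\<exists>q. sublinear q \<and> (\<forall>x. q x \<le> p x) \<and> (\<forall>k\<in>K. q (- k) \<le> - d)"
proof -
  define S where "S x = {p (x + t *\<^sub>R k) - t * d |t k. 0 \<le> t \<and> k \<in> K}" for x
  define q where "q x = Inf (S x)" for x
  have S_ne: "S x \<noteq> {}" for x
    unfolding S_def using K(2) by fastforce
  have S_lower: "- p (- x) \<le> a" if "a \<in> S x" for a x
  proof -
    from that obtain t k where tk: "0 \<le> t" "k \<in> K" "a = p (x + t *\<^sub>R k) - t * d"
      by (auto simp: S_def)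
    have "t * d \<le> t * p k" using tk d by (simp add: mult_left_mono)
    also have "\<dots> = p ((x + t *\<^sub>R k) + (- x))" using sublinear_scale[OF p] tk by simp
    also have "\<dots> \<le> p (x + t *\<^sub>R k) + p (- x)" by (rule sublinear_add[OF p])
    finally show ?thesis using tk by simp
  qed
  have q_le: "q x \<le> a" if "a \<in> S x" for a x
    unfolding q_def using that S_lower by (intro cInf_lower bdd_belowI) auto
  have le_q: "b \<le> q x" if "\<And>a. a \<in> S x \<Longrightarrow> b \<le> a" for b x
    unfolding q_def using that S_ne by (intro cInf_greatest) auto
  have S_I: "p (x + t *\<^sub>R k) - t * d \<in> S x" if "0 \<le> t" "k \<in> K" for x t k
    unfolding S_def using that by blast
  obtain k0 where k0: "k0 \<in> K" using K by blast
  have q_le_p: "q x \<le> p x" for x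
    using q_le[OF S_I[of 0 k0 x]] k0 by simp
  have S_add: "\<exists>c\<in>S (x + y). c \<le> a + b" if "a \<in> S x" "b \<in> S y" for a b x y
  proof -
    from that obtain t k s l where
      a: "0 \<le> t" "k \<in> K" "a = p (x + t *\<^sub>R k) - t * d" and
      b: "0 \<le> s" "l \<in> K" "b = p (y + s *\<^sub>R l) - s * d"
      by (auto simp: S_def)
    \<comment> \<open>The cone over \<open>K\<close> is closed under addition.\<close>
    obtain m where m: "m \<in> K" "(t + s) *\<^sub>R m = t *\<^sub>R k + s *\<^sub>R l"
    proof (cases "t + s = 0")
      case True
      with a b have "t = 0" "s = 0" by auto
      then show ?thesis using that[of k] a by simp
    next
      case False
      then have "(t / (t + s)) *\<^sub>R k + (s / (t + s)) *\<^sub>R l \<in> K"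
        using K(1) a b by (intro convexD) (auto simp: add_divide_distrib[symmetric])
      then show ?thesis using that False
        by (auto simp: scaleR_add_right)
    qed
    have "x + y + (t + s) *\<^sub>R m = (x + t *\<^sub>R k) + (y + s *\<^sub>R l)"
      unfolding m(2) by (simp only: add_ac)
    then have "p (x + y + (t + s) *\<^sub>R m) \<le> p (x + t *\<^sub>R k) + p (y + s *\<^sub>R l)"
      using sublinear_add[OF p, of "x + t *\<^sub>R k" "y + s *\<^sub>R l"] by (simp only:)
    then show ?thesis
      using S_I[of "t + s" m "x + y"] a b m by (intro bexI) (auto simp: algebra_simps)
  qed
  have "sublinear q"
  proof (rule sublinearI)
    fix x y
    have *: "q (x + y) - b \<le> q x" if "b \<in> S y" for b
    proof (rule le_q)
      fix a assume "a \<in> S x"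
      from S_add[OF this that] q_le show "q (x + y) - b \<le> a" by fastforce
    qed
    have "q (x + y) - q x \<le> q y"
      by (rule le_q) (use * in fastforce)
    then show "q (x + y) \<le> q x + q y" by simp
  next
    have "0 \<le> q 0" by (rule le_q) (use S_lower[of _ 0] sublinear_zero[OF p] in auto)
    with q_le_p[of 0] show "q 0 = 0" by (simp add: sublinear_zero[OF p])
  next
    fix r :: real and x assume r: "0 < r"
    have "q (r *\<^sub>R x) / r \<le> q x"
    proof (rule le_q)
      fix a assume "a \<in> S x"
      then obtain t k where tk: "0 \<le> t" "k \<in> K" "a = p (x + t *\<^sub>R k) - t * d"
        by (auto simp: S_def)
      have "q (r *\<^sub>R x) \<le> p (r *\<^sub>R x + (r * t) *\<^sub>R k) - (r * t) * d"
        by (rule q_le, rule S_I) (use tk r in auto)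
      also have "p (r *\<^sub>R x + (r * t) *\<^sub>R k) = r * p (x + t *\<^sub>R k)"
        using sublinear_scale[OF p, of r "x + t *\<^sub>R k"] r by (simp add: scaleR_add_right)
      finally have "q (r *\<^sub>R x) \<le> r * a" unfolding tk(3) by (simp add: right_diff_distrib mult.assoc)
      then show "q (r *\<^sub>R x) / r \<le> a" using r by (simp add: field_simps)
    qed
    then show "q (r *\<^sub>R x) \<le> r * q x" using r by (simp add: field_simps)
  qed
  moreover have "q (- k) \<le> - d" if "k \<in> K" for k
    using q_le[OF S_I[of 1 k "- k"]] that by (simp add: sublinear_zero[OF p])
  ultimately show ?thesis using q_le_p by blast
qed

text \<open>
  Zorn's lemma: the pointwise infimum of a chain of sublinear functionals below \<open>p\<close> is again
  sublinear, and it is finite because all of them are at least \<open>- p (- x)\<close> at \<open>x\<close>.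
\<close>

lemma minimal_sublinear_exists:
  assumes p: "sublinear p"
  shows "\<exists>m. sublinear m \<and> (\<forall>x. m x \<le> p x) \<and>
    (\<forall>q. sublinear q \<longrightarrow> (\<forall>x. q x \<le> m x) \<longrightarrow> q = m)"
proof -
  define A where "A = {q. sublinear q \<and> (\<forall>x. q x \<le> p x)}"
  have "\<exists>m\<in>A. \<forall>a\<in>A. a \<le> m \<longrightarrow> a = m"
  proof (rule predicate_Zorn)
    show "partial_order_on A (relation_of (\<lambda>a b. b \<le> a) A)"
      by (rule partial_order_on_relation_ofI) auto
  next
    fix C assume "C \<in> Chains (relation_of (\<lambda>a b. b \<le> a) A)"
    then have CA: "C \<subseteq> A" and chain: "\<And>a b. a \<in> C \<Longrightarrow> b \<in> C \<Longrightarrow> a \<le> b \<or> b \<le> a"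
      by (auto simp: Chains_def relation_of_def)
    show "\<exists>u\<in>A. \<forall>a\<in>C. u \<le> a"
    proof (cases "C = {}")
      case True
      then show ?thesis using p by (auto simp: A_def)
    next
      case False
      have low: "- p (- x) \<le> a x" if "a \<in> C" for a x
        using that CA sublinear_minus[of a x] unfolding A_def by (smt (verit) mem_Collect_eq subset_eq)
      define u where "u x = (INF a\<in>C. a x)" for x
      have u_le: "u x \<le> a x" if "a \<in> C" for a x
        unfolding u_def using that low by (intro cINF_lower bdd_belowI2) auto
      have le_u: "b \<le> u x" if "\<And>a. a \<in> C \<Longrightarrow> b \<le> a x" for b x
        unfolding u_def using that False by (intro cINF_greatest) auto
      have sub: "sublinear a" if "a \<in> C" for a using that CA by (auto simp: A_def)
      obtain a0 where a0: "a0 \<in> C" using False by blast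
      have "sublinear u"
      proof (rule sublinearI)
        fix x y
        have *: "u (x + y) \<le> a x + b y" if ab: "a \<in> C" "b \<in> C" for a b
        proof -
          obtain c where c: "c \<in> C" "c \<le> a" "c \<le> b"
            using chain[OF ab] ab by blast
          have "u (x + y) \<le> c x + c y"
            using u_le[OF c(1)] sublinear_add[OF sub[OF c(1)]] by (meson order_trans)
          also have "\<dots> \<le> a x + b y" using c by (intro add_mono) (auto simp: le_fun_def)
          finally show ?thesis .
        qed
        have **: "u (x + y) - b y \<le> u x" if "b \<in> C" for b
          by (rule le_u) (use *[OF _ that] in \<open>simp add: algebra_simps\<close>)
        have "u (x + y) - u x \<le> u y"
          by (rule le_u) (use ** in fastforce)
        then show "u (x + y) \<le> u x + u y" by simp
      next
        have "0 \<le> u 0" by (rule le_u) (simp add: sublinear_zero sub)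
        with u_le[OF a0, of 0] show "u 0 = 0" by (simp add: sublinear_zero sub a0)
      next
        fix t :: real and x assume t: "0 < t"
        have "u (t *\<^sub>R x) / t \<le> u x"
        proof (rule le_u)
          fix a assume "a \<in> C"
          then show "u (t *\<^sub>R x) / t \<le> a x"
            using u_le[of a "t *\<^sub>R x"] sublinear_scale[OF sub, of a t x] t by (simp add: field_simps)
        qed
        then show "u (t *\<^sub>R x) \<le> t * u x" using t by (simp add: field_simps)
      qed
      moreover have "u x \<le> p x" for x
        using u_le[OF a0, of x] a0 CA unfolding A_def by (blast intro: order_trans)
      ultimately show ?thesis
        using u_le by (auto simp: A_def le_fun_def)
    qed
  qed
  then obtain m where m: "m \<in> A" "\<And>a. a \<in> A \<Longrightarrow> a \<le> m \<Longrightarrow> a = m" by blast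
  have "q = m" if "sublinear q" "\<forall>x. q x \<le> m x" for q
    using m that by (intro m(2)) (auto simp: A_def le_fun_def intro: order_trans)
  with m(1) show ?thesis by (auto simp: A_def)
qed

text \<open>
  A minimal sublinear functional \<open>f\<close> is linear. Indeed the construction for the singleton \<open>{x}\<close> and
  the bound \<open>f x\<close> yields a sublinear functional below \<open>f\<close> that is at most \<open>- f x\<close> at \<open>- x\<close>; by
  minimality it is \<open>f\<close> itself, so \<open>f\<close> is odd, and odd sublinear functionals are linear.
\<close>

theorem Hahn_Banach_convex:
  assumes p: "sublinear p" and K: "convex K" "K \<noteq> {}" and d: "\<And>k. k \<in> K \<Longrightarrow> d \<le> p k"
  shows "\<exists>f. linear f \<and> (\<forall>x. f x \<le> p x) \<and> (\<forall>k\<in>K. d \<le> f k)"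
proof -
  obtain q where q: "sublinear q" "\<And>x. q x \<le> p x" "\<And>k. k \<in> K \<Longrightarrow> q (- k) \<le> - d"
    using sublinear_below_on_convex[OF p K d] by blast
  obtain f where f: "sublinear f" "\<And>x. f x \<le> q x"
    and min: "\<And>g. sublinear g \<Longrightarrow> (\<And>x. g x \<le> f x) \<Longrightarrow> g = f"
    using minimal_sublinear_exists[OF q(1)] by blast
  have neg: "f (- x) = - f x" for x
  proof -
    obtain g where "sublinear g" "\<And>y. g y \<le> f y" "g (- x) \<le> - f x"
      using sublinear_below_on_convex[OF f(1), of "{x}" "f x"] by auto
    with min[of g] have "f (- x) \<le> - f x" by simp
    with sublinear_minus[OF f(1), of x] show ?thesis by simp
  qed
  have "linear f"
  proof (rule linearI)
    fix x y
    show "f (x + y) = f x + f y"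
      using sublinear_add[OF f(1), of x y] sublinear_add[OF f(1), of "x + y" "- y"] neg[of y] by simp
  next
    fix r x
    show "f (r *\<^sub>R x) = r *\<^sub>R f x"
      using sublinear_scale[OF f(1), of r x] sublinear_scale[OF f(1), of "- r" x] neg[of "r *\<^sub>R x"]
      by (cases "0 \<le> r") auto
  qed
  moreover have "d \<le> f k" if "k \<in> K" for k
    using f(2)[of "- k"] q(3)[OF that] neg[of k] by simp
  moreover have "f x \<le> p x" for x
    using f(2) q(2) by (rule order_trans)
  ultimately show ?thesis by blast
qed

section \<open>Separation by continuous functionals\<close>

lemma blinfun_of_linear_dominated:
  fixes f :: "'a::real_normed_vector \<Rightarrow> real"
  assumes "linear f" "\<And>x. f x \<le> C * norm x"
  shows "\<exists>g :: 'a \<Rightarrow>\<^sub>L real. blinfun_apply g = f"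
proof -
  have "\<bar>f x\<bar> \<le> C * norm x" for x
    using assms(2)[of x] assms(2)[of "- x"] linear_neg[OF assms(1), of x] by simp
  then have "bounded_linear f"
    using assms(1) by (intro bounded_linear_intro[of _ C])
      (auto simp: linear_add linear_scale mult.commute)
  then show ?thesis by (metis bounded_linear_Blinfun_apply)
qed

text \<open>
  Hahn--Banach for the norm and the translate \<open>C - x\<close>. The functional has norm at most \<open>1\<close> and
  still exhibits the full distance \<open>d\<close>, so that the case of a single point gives norming functionals.
\<close>

lemma functional_separating_from_convex:
  fixes x :: "'a::real_normed_vector"
  assumes "convex C" "C \<noteq> {}" "\<And>k. k \<in> C \<Longrightarrow> d \<le> norm (k - x)"
  shows "\<exists>f :: 'a \<Rightarrow>\<^sub>L real. (\<forall>z. blinfun_apply f z \<le> norm z) \<and>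
    (\<forall>k\<in>C. blinfun_apply f x + d \<le> blinfun_apply f k)"
proof -
  have "sublinear (norm :: 'a \<Rightarrow> real)"
    by (auto simp: sublinear_def norm_triangle_ineq)
  moreover have "convex ((\<lambda>k. k - x) ` C)" by (simp add: assms)
  ultimately have "\<exists>f. linear f \<and> (\<forall>z. f z \<le> norm z) \<and> (\<forall>k\<in>(\<lambda>k. k - x) ` C. d \<le> f k)"
    using assms(2,3) by (intro Hahn_Banach_convex) auto
  then obtain f where f: "linear f" "\<And>z. f z \<le> norm z" "\<And>k. k \<in> C \<Longrightarrow> d \<le> f (k - x)"
    by blast
  obtain g :: "'a \<Rightarrow>\<^sub>L real" where "blinfun_apply g = f"
    using blinfun_of_linear_dominated[of f 1] f by auto
  then show ?thesis
    using f by (intro exI[of _ g]) (auto simp: linear_diff algebra_simps)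
qed

corollary norming_functional:
  fixes x :: "'a::real_normed_vector"
  shows "\<exists>f :: 'a \<Rightarrow>\<^sub>L real. (\<forall>z. blinfun_apply f z \<le> norm z) \<and> blinfun_apply f x = norm x"
  using functional_separating_from_convex[of "{x}" "norm x" 0] by (force intro: order_antisym)

section \<open>Weakly adherent points of sequences\<close>

text \<open>
  The condition says that \<open>f x \<le> limsup f (u n)\<close> for every continuous functional \<open>f\<close>; with \<open>- f\<close>
  it also gives \<open>liminf f (u n) \<le> f x\<close>. This is weaker than being a weak cluster point, but it
  suffices to locate \<open>x\<close> and needs no subnets. Eventual upper bounds replace the upper limit so
  that everything stays in the reals.
\<close>

definition weakly_adherent :: "(nat \<Rightarrow> 'a::real_normed_vector) \<Rightarrow> 'a \<Rightarrow> bool"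
  where "weakly_adherent u x \<longleftrightarrow>
    (\<forall>(f :: 'a \<Rightarrow>\<^sub>L real) c. (\<forall>\<^sub>F n in sequentially. blinfun_apply f (u n) \<le> c) \<longrightarrow> blinfun_apply f x \<le> c)"

lemma weakly_adherentD:
  fixes f :: "'a::real_normed_vector \<Rightarrow>\<^sub>L real"
  shows
  "weakly_adherent u x \<Longrightarrow> (\<forall>\<^sub>F n in sequentially. blinfun_apply f (u n) \<le> c) \<Longrightarrow> blinfun_apply f x \<le> c"
  by (auto simp: weakly_adherent_def)

lemma weakly_converges_imp_weakly_adherent:
  assumes "weakly_converges u x" shows "weakly_adherent u x"
  unfolding weakly_adherent_def
proof (intro allI impI)
  fix f :: "'a \<Rightarrow>\<^sub>L real" and c
  assume "\<forall>\<^sub>F n in sequentially. blinfun_apply f (u n) \<le> c"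
  then show "blinfun_apply f x \<le> c"
    using assms unfolding weakly_converges_def by (intro tendsto_upperbound) auto
qed

lemma weakly_adherent_limit:
  fixes f :: "'a::real_normed_vector \<Rightarrow>\<^sub>L real"
  assumes x: "weakly_adherent u x"
    and l: "(\<lambda>n. blinfun_apply f (u n)) \<longlonglongrightarrow> l"
  shows "blinfun_apply f x = l"
proof (rule order_antisym)
  have "blinfun_apply f x \<le> c" if "l < c" for c
    using order_tendstoD(2)[OF l that] by (intro weakly_adherentD[OF x]) (auto elim: eventually_mono)
  then show "blinfun_apply f x \<le> l" by (rule dense_ge)
  have "c \<le> blinfun_apply f x" if "c < l" for c
  proof -
    have "\<forall>\<^sub>F n in sequentially. blinfun_apply (- f) (u n) \<le> - c"
      using order_tendstoD(1)[OF l that] by eventually_elim (simp add: blinfun.minus_left)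
    from weakly_adherentD[OF x this] show ?thesis by (simp add: blinfun.minus_left)
  qed
  then show "l \<le> blinfun_apply f x" by (rule dense_le)
qed

text \<open>
  Mazur's theorem: a functional that strictly separates \<open>x\<close> from \<open>C\<close> would violate adherence.
\<close>

lemma weakly_adherent_in_closure_convex:
  assumes x: "weakly_adherent u x" and C: "convex C" "\<And>n. u n \<in> C"
  shows "x \<in> closure C"
proof (rule ccontr)
  assume "x \<notin> closure C"
  then obtain d where d: "0 < d" "\<And>k. k \<in> C \<Longrightarrow> d \<le> norm (k - x)"
    by (auto simp: closure_approachable dist_norm not_less)
  obtain f :: "'a \<Rightarrow>\<^sub>L real" where f: "\<And>k. k \<in> C \<Longrightarrow> blinfun_apply f x + d \<le> blinfun_apply f k"
    using functional_separating_from_convex[OF C(1) _ d(2)] C(2) by blast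
  have "blinfun_apply (- f) x \<le> - (blinfun_apply f x + d)"
    by (rule weakly_adherentD[OF x]) (use f[OF C(2)] in \<open>auto intro!: always_eventually simp: blinfun.minus_left algebra_simps\<close>)
  with d show False by (simp add: blinfun.minus_left)
qed

section \<open>Weak sequential compactness in reflexive spaces\<close>

text \<open>
  The upper limit of \<open>f (u n)\<close>, as a function \<open>p\<close> of \<open>f\<close>, is sublinear on the dual space and
  bounded by a multiple of the norm. Hahn--Banach gives a linear functional below \<open>p\<close> that agrees
  with \<open>p\<close> at \<open>g\<close>, and reflexivity represents it by a point. This takes the place of the
  Banach--Alaoglu theorem.
\<close>

lemma weakly_adherent_attaining_limsup:
  fixes u :: "nat \<Rightarrow> 'a::real_normed_vector" and g :: "'a \<Rightarrow>\<^sub>L real"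
  assumes refl: "reflexive_space TYPE('a)" and bdd: "bounded (range u)"
  shows "\<exists>x. weakly_adherent u x \<and>
    (\<forall>c > blinfun_apply g x. \<forall>\<^sub>F n in sequentially. blinfun_apply g (u n) < c)"
proof -
  obtain R where R: "\<And>n. norm (u n) \<le> R"
    using bdd by (auto simp: bounded_iff)
  define E where "E f = {c. \<forall>\<^sub>F n in sequentially. blinfun_apply f (u n) \<le> c}" for f :: "'a \<Rightarrow>\<^sub>L real"
  define p where "p f = Inf (E f)" for f
  have bound: "\<bar>blinfun_apply f (u n)\<bar> \<le> R * norm f" for f n
    using norm_blinfun[of f "u n"] mult_left_mono[OF R, of "norm f" n] by (simp add: mult.commute)
  have E_top: "R * norm f \<in> E f" for f
    unfolding E_def using bound[of f] by (auto simp: abs_le_iff)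
  have E_low: "- (R * norm f) \<le> c" if "c \<in> E f" for c f
  proof -
    from that obtain n where "blinfun_apply f (u n) \<le> c"
      by (auto simp: E_def eventually_sequentially)
    with bound[of f n] show ?thesis by linarith
  qed
  have p_le: "p f \<le> c" if "c \<in> E f" for c f
    unfolding p_def using that E_low by (intro cInf_lower bdd_belowI) auto
  have le_p: "b \<le> p f" if "\<And>c. c \<in> E f \<Longrightarrow> b \<le> c" for b f
    unfolding p_def using that E_top by (intro cInf_greatest) auto
  have p_sub: "sublinear p"
  proof (rule sublinearI)
    fix f h
    have *: "p (f + h) \<le> a + b" if "a \<in> E f" "b \<in> E h" for a b
    proof (rule p_le)
      show "a + b \<in> E (f + h)"
        using that unfolding E_def mem_Collect_eq
        by eventually_elim (simp add: blinfun.add_left)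
    qed
    have **: "p (f + h) - b \<le> p f" if "b \<in> E h" for b
      by (rule le_p) (use *[OF _ that] in \<open>simp add: algebra_simps\<close>)
    have "p (f + h) - p f \<le> p h"
      by (rule le_p) (use ** in fastforce)
    then show "p (f + h) \<le> p f + p h" by simp
  next
    have "0 \<le> p 0" by (rule le_p) (use E_low[of _ 0] in simp)
    with p_le[OF E_top[of 0]] show "p 0 = 0" by simp
  next
    fix t :: real and f assume t: "0 < t"
    have "p (t *\<^sub>R f) / t \<le> p f"
    proof (rule le_p)
      fix c assume "c \<in> E f"
      then have "t * c \<in> E (t *\<^sub>R f)"
        unfolding E_def mem_Collect_eq
        by eventually_elim (use t in \<open>simp add: blinfun.scaleR_left\<close>)
      from p_le[OF this] show "p (t *\<^sub>R f) / t \<le> c" using t by (simp add: field_simps)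
    qed
    then show "p (t *\<^sub>R f) \<le> t * p f" using t by (simp add: field_simps)
  qed
  obtain F where F: "linear F" "\<And>f. F f \<le> p f" "p g \<le> F g"
    using Hahn_Banach_convex[OF p_sub, of "{g}" "p g"] by auto
  have "F f \<le> R * norm f" for f
    using F(2) p_le[OF E_top] by (rule order_trans)
  then obtain G where G: "blinfun_apply G = F"
    using blinfun_of_linear_dominated[OF F(1)] by blast
  obtain x :: 'a where "G = bidual_embedding x"
    using refl unfolding reflexive_space_def by (metis surjD)
  with G have Fx: "F f = blinfun_apply f x" for f by auto
  have "weakly_adherent u x"
    unfolding weakly_adherent_def
  proof (intro allI impI)
    fix f :: "'a \<Rightarrow>\<^sub>L real" and c
    assume "\<forall>\<^sub>F n in sequentially. blinfun_apply f (u n) \<le> c"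
    then have "p f \<le> c" by (intro p_le) (simp add: E_def)
    with F(2)[of f] show "blinfun_apply f x \<le> c" by (simp add: Fx)
  qed
  moreover have "\<forall>\<^sub>F n in sequentially. blinfun_apply g (u n) < c" if "blinfun_apply g x < c" for c
  proof -
    have "\<exists>b\<in>E g. b < c"
    proof (rule ccontr)
      assume "\<not> (\<exists>b\<in>E g. b < c)"
      then have "c \<le> p g" by (intro le_p) auto
      with F(3) that show False by (simp add: Fx)
    qed
    then show ?thesis unfolding E_def by (auto elim: eventually_mono)
  qed
  ultimately show ?thesis by blast
qed

text \<open>
  For each \<open>g\<close> some adherent point attains the upper limit of \<open>g (u n)\<close>. If there is only one
  adherent point \<open>x\<close>, then \<open>g x\<close> is this upper limit, and, using \<open>- g\<close>, also the lower limit.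
\<close>

lemma weakly_converges_if_unique_adherent:
  fixes u :: "nat \<Rightarrow> 'a::real_normed_vector"
  assumes "reflexive_space TYPE('a)" "bounded (range u)"
    and unique: "\<And>x y. weakly_adherent u x \<Longrightarrow> weakly_adherent u y \<Longrightarrow> x = y"
  shows "\<exists>x. weakly_converges u x"
proof -
  obtain x where x: "weakly_adherent u x"
    using weakly_adherent_attaining_limsup[OF assms(1,2)] by blast
  have up: "\<forall>\<^sub>F n in sequentially. blinfun_apply g (u n) < c" if "blinfun_apply g x < c"
    for g :: "'a \<Rightarrow>\<^sub>L real" and c
  proof -
    obtain y where "weakly_adherent u y"
      and y: "\<And>c. blinfun_apply g y < c \<Longrightarrow> \<forall>\<^sub>F n in sequentially. blinfun_apply g (u n) < c"
      using weakly_adherent_attaining_limsup[OF assms(1,2), of g] by blast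
    with unique[OF x] have "x = y" by blast
    with y that show ?thesis by blast
  qed
  have "(\<lambda>n. blinfun_apply g (u n)) \<longlonglongrightarrow> blinfun_apply g x" for g :: "'a \<Rightarrow>\<^sub>L real"
  proof (rule order_tendstoI)
    fix c assume "c < blinfun_apply g x"
    then have "\<forall>\<^sub>F n in sequentially. blinfun_apply (- g) (u n) < - c"
      by (intro up) (simp add: blinfun.minus_left)
    then show "\<forall>\<^sub>F n in sequentially. c < blinfun_apply g (u n)"
      by eventually_elim (simp add: blinfun.minus_left)
  qed (rule up)
  then show ?thesis unfolding weakly_converges_def by blast
qed

text \<open>
  \<open>D\<close> consists of the rational linear combinations of the terms of the sequence, represented by
  lists of coefficient-index pairs: lists are countable in number, and appending them adds the
  combinations.
\<close>

lemma separable_subspace_containing_sequence: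
  fixes u :: "nat \<Rightarrow> 'a::real_normed_vector"
  shows "\<exists>D. countable D \<and> D \<noteq> {} \<and> subspace (closure D) \<and> range u \<subseteq> closure D"
proof -
  define comb where "comb l = (\<Sum>(q, n)\<leftarrow>l. (of_rat q :: real) *\<^sub>R u n)" for l :: "(rat \<times> nat) list"
  define D where "D = range comb"
  have comb_add: "comb l + comb m = comb (l @ m)" for l m by (simp add: comb_def)
  have comb_scale: "(of_rat r :: real) *\<^sub>R comb l = comb (map (\<lambda>(q, n). (r * q, n)) l)" for r l
    by (induction l) (auto simp: comb_def scaleR_add_right of_rat_mult)
  have D_add: "x + y \<in> D" if "x \<in> D" "y \<in> D" for x y
    using that by (auto simp: D_def comb_add)
  have D_scale: "r *\<^sub>R x \<in> D" if "r \<in> \<rat>" "x \<in> D" for r x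
    using that by (auto simp: D_def comb_scale elim!: Rats_cases)
  have in_closure: "comb l \<in> closure D" for l
    using closure_subset[of D] by (auto simp: D_def)
  have "subspace (closure D)"
    unfolding subspace_def
  proof (intro conjI ballI allI)
    show "0 \<in> closure D" using in_closure[of "[]"] by (simp add: comb_def)
  next
    fix x y assume "x \<in> closure D" "y \<in> closure D"
    then obtain a b where "\<And>n. a n \<in> D" "a \<longlonglongrightarrow> x" "\<And>n. b n \<in> D" "b \<longlonglongrightarrow> y"
      unfolding closure_sequential by blast
    then show "x + y \<in> closure D"
      unfolding closure_sequential using D_add
      by (intro exI[of _ "\<lambda>n. a n + b n"]) (auto intro: tendsto_add)
  next
    fix c :: real and x assume "x \<in> closure D"
    then obtain a where a: "\<And>n. a n \<in> D" "a \<longlonglongrightarrow> x"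
      unfolding closure_sequential by blast
    have "c \<in> closure \<rat>" by (simp add: Rats_closure_real)
    then obtain r where r: "\<And>n. r n \<in> \<rat>" "r \<longlonglongrightarrow> c"
      unfolding closure_sequential by blast
    show "c *\<^sub>R x \<in> closure D"
      unfolding closure_sequential using D_scale a r
      by (intro exI[of _ "\<lambda>n. r n *\<^sub>R a n"]) (auto intro: tendsto_scaleR)
  qed
  moreover have "range u \<subseteq> closure D"
  proof
    fix x assume "x \<in> range u"
    then obtain n where "x = comb [(1, n)]" by (auto simp: comb_def)
    then show "x \<in> closure D" by (simp add: in_closure)
  qed
  moreover have "countable D" "D \<noteq> {}" by (auto simp: D_def)
  ultimately show ?thesis by blast
qed

text \<open>
  Norming functionals of the points \<open>d j\<close> suffice: if all of them vanish at \<open>z\<close>, then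
  \<open>norm (d j) \<le> norm (d j - z)\<close> for all \<open>j\<close>, and letting \<open>d j\<close> approach \<open>z\<close> forces \<open>z = 0\<close>.
\<close>

lemma countable_separating_functionals:
  fixes d :: "nat \<Rightarrow> 'a::real_normed_vector"
  shows "\<exists>f :: nat \<Rightarrow> 'a \<Rightarrow>\<^sub>L real. (\<forall>j z. \<bar>blinfun_apply (f j) z\<bar> \<le> norm z) \<and>
    (\<forall>z \<in> closure (range d). (\<forall>j. blinfun_apply (f j) z = 0) \<longrightarrow> z = 0)"
proof -
  have "\<exists>f. \<forall>j. (\<forall>z. blinfun_apply (f j) z \<le> norm z) \<and> blinfun_apply (f j :: 'a \<Rightarrow>\<^sub>L real) (d j) = norm (d j)"
    using norming_functional by (intro choice allI)
  then obtain f :: "nat \<Rightarrow> 'a \<Rightarrow>\<^sub>L real" where f: "\<And>j z. blinfun_apply (f j) z \<le> norm z"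
      "\<And>j. blinfun_apply (f j) (d j) = norm (d j)"
    by blast
  have "\<bar>blinfun_apply (f j) z\<bar> \<le> norm z" for j z
    using f(1)[of j z] f(1)[of j "- z"] by (simp add: blinfun.minus_right)
  moreover have "z = 0" if z: "z \<in> closure (range d)" "\<And>j. blinfun_apply (f j) z = 0" for z
  proof (rule ccontr)
    assume "z \<noteq> 0"
    then have "norm z / 2 > 0" by simp
    with z(1) have "\<exists>y\<in>range d. dist y z < norm z / 2"
      unfolding closure_approachable by blast
    then obtain j where j: "norm (d j - z) < norm z / 2"
      by (auto simp: dist_norm)
    have "norm (d j) = blinfun_apply (f j) (d j - z)"
      using f(2) z(2) by (simp add: blinfun.diff_right)
    also have "\<dots> \<le> norm (d j - z)" by (rule f(1))
    finally show False
      using j norm_triangle_ineq2[of z "z - d j"] norm_minus_commute[of z "d j"] by simp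
  qed
  ultimately show ?thesis by blast
qed

text \<open>
  The usual diagonal argument is sequential compactness of a countable product of compact intervals,
  which is metrizable.
\<close>

lemma bounded_real_sequences_common_subseq:
  fixes a :: "nat \<Rightarrow> nat \<Rightarrow> real"
  assumes "\<And>n j. \<bar>a n j\<bar> \<le> R"
  shows "\<exists>(s :: nat \<Rightarrow> nat) l. strict_mono s \<and> (\<forall>j. (\<lambda>n. a (s n) j) \<longlonglongrightarrow> l j)"
proof -
  have "compactin (product_topology (\<lambda>j::nat. euclidean :: real topology) UNIV) (PiE UNIV (\<lambda>j. {-R..R}))"
    by (subst compactin_PiE) auto
  then have "compact (PiE UNIV (\<lambda>j::nat. {-R..R}))"
    by (simp add: euclidean_product_topology)
  moreover have "\<forall>n. a n \<in> PiE UNIV (\<lambda>j. {-R..R})"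
    using assms by (auto simp: abs_le_iff minus_le_iff)
  ultimately obtain l :: "nat \<Rightarrow> real" and s where s: "strict_mono (s :: nat \<Rightarrow> nat)" "(a \<circ> s) \<longlonglongrightarrow> l"
    unfolding compact_eq_seq_compact_metric seq_compact_def by metis
  have "(\<lambda>n. a (s n) j) \<longlonglongrightarrow> l j" for j
    using continuous_on_tendsto_compose[OF continuous_on_product_coordinates[of j] s(2)]
    by (simp add: o_def)
  with s(1) show ?thesis by blast
qed

text \<open>
  Adherent points of a subsequence of \<open>u\<close> lie in the separable subspace \<open>closure D\<close>, by Mazur's
  theorem. Countably many functionals \<open>f j\<close> separate the points there, so making all the \<open>f j\<close>
  converge along the subsequence leaves room for only one adherent point.
\<close>

theorem reflexive_bounded_weakly_convergent_subseq:
  fixes u :: "nat \<Rightarrow> 'a::real_normed_vector"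
  assumes refl: "reflexive_space TYPE('a)" and bdd: "bounded (range u)"
  shows "\<exists>(s :: nat \<Rightarrow> nat) x. strict_mono s \<and> weakly_converges (u \<circ> s) x"
proof -
  obtain D where D: "countable D" "D \<noteq> {}" and subspace: "subspace (closure D)"
    and u_D: "range u \<subseteq> closure D"
    using separable_subspace_containing_sequence[of u] by blast
  have range_D: "range (from_nat_into D) = D"
    using D by (simp add: range_from_nat_into)
  obtain f :: "nat \<Rightarrow> 'a \<Rightarrow>\<^sub>L real" where f: "\<And>j z. \<bar>blinfun_apply (f j) z\<bar> \<le> norm z"
    and sep: "\<And>z. z \<in> closure D \<Longrightarrow> (\<And>j. blinfun_apply (f j) z = 0) \<Longrightarrow> z = 0"
    using countable_separating_functionals[of "from_nat_into D"] unfolding range_D by metis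
  obtain R where R: "\<And>n. norm (u n) \<le> R"
    using bdd by (auto simp: bounded_iff)
  have "\<bar>blinfun_apply (f j) (u n)\<bar> \<le> R" for n j
    using f R by (rule order_trans)
  then obtain s :: "nat \<Rightarrow> nat" and l where s: "strict_mono s"
    and l: "\<And>j. (\<lambda>n. blinfun_apply (f j) (u (s n))) \<longlonglongrightarrow> l j"
    using bounded_real_sequences_common_subseq[of "\<lambda>n j. blinfun_apply (f j) (u n)" R] by blast
  have "\<exists>x. weakly_converges (u \<circ> s) x"
  proof (rule weakly_converges_if_unique_adherent[OF refl])
    show "bounded (range (u \<circ> s))"
      using bdd by (rule bounded_subset) auto
  next
    fix x y assume xy: "weakly_adherent (u \<circ> s) x" "weakly_adherent (u \<circ> s) y"
    have "z \<in> closure D" if "weakly_adherent (u \<circ> s) z" for z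
      using weakly_adherent_in_closure_convex[OF that, of "closure D"] subspace u_D
      by (auto intro: subspace_imp_convex)
    then have "x - y \<in> closure D"
      using xy subspace by (intro subspace_diff) auto
    moreover have "blinfun_apply (f j) (x - y) = 0" for j
      using weakly_adherent_limit[OF xy(1), of "f j" "l j"]
        weakly_adherent_limit[OF xy(2), of "f j" "l j"] l
      by (simp add: o_def blinfun.diff_right)
    ultimately have "x - y = 0" by (rule sep)
    then show "x = y" by simp
  qed
  with s show ?thesis by blast
qed

section \<open>Quasiuniform lower semicontinuity\<close>

lemma weakly_converges_shift:
  fixes u v :: "nat \<Rightarrow> 'a::real_normed_vector"
  assumes u: "weakly_converges u x" and uv: "(\<lambda>n. u n - v n) \<longlonglongrightarrow> 0"
  shows "weakly_converges v x"
  unfolding weakly_converges_def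
proof
  fix f :: "'a \<Rightarrow>\<^sub>L real"
  have "(\<lambda>n. blinfun_apply f (u n) - blinfun_apply f (u n - v n)) \<longlonglongrightarrow> blinfun_apply f x - blinfun_apply f 0"
    using u[unfolded weakly_converges_def, rule_format] blinfun.tendsto[OF tendsto_const uv]
    by (rule tendsto_diff)
  then show "(\<lambda>n. blinfun_apply f (v n)) \<longlonglongrightarrow> blinfun_apply f x"
    by (simp add: blinfun.diff_right)
qed

text \<open>
  If \<open>x\<close> is within \<open>\<rho>\<close> of a point \<open>v\<close> of the convex hull, then the translation by \<open>x - v\<close> moves \<open>V\<close>
  into \<open>U\<close>. As \<open>U\<close> is convex, it moves the whole hull into \<open>U\<close>, and it moves \<open>v\<close> to \<open>x\<close>.
\<close>

lemma EI_closure_convex_hull_subset: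
  assumes "convex U" "V \<in> EI U"
  shows "closure (convex hull V) \<subseteq> U"
proof
  fix x assume x: "x \<in> closure (convex hull V)"
  obtain \<rho> where \<rho>: "\<rho> > 0" "\<And>v. v \<in> V \<Longrightarrow> ball v \<rho> \<subseteq> U"
    using assms(2) by (auto simp: EI_def)
  obtain v where v: "v \<in> convex hull V" "dist v x < \<rho>"
    using x \<rho>(1) by (auto simp: closure_approachable)
  have "V \<subseteq> (\<lambda>y. y - (x - v)) ` U"
  proof
    fix w assume w: "w \<in> V"
    have "w + (x - v) \<in> ball w \<rho>"
      using v(2) by (simp add: dist_norm norm_minus_commute)
    with \<rho>(2)[OF w] show "w \<in> (\<lambda>y. y - (x - v)) ` U"
      by (intro image_eqI[of _ _ "w + (x - v)"]) auto
  qed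
  then have "convex hull V \<subseteq> (\<lambda>y. y - (x - v)) ` U"
    by (rule hull_minimal) (simp add: assms(1))
  with v(1) show "x \<in> U" by auto
qed

lemma Lambda_circ_less_sequences:
  assumes "Lambda_circ V \<phi>1 \<phi>2 < c"
  shows "\<exists>a b. (\<forall>n::nat. a n \<in> V \<and> b n \<in> V \<and> \<phi>1 (a n) + \<phi>2 (b n) < c) \<and> (\<lambda>n. a n - b n) \<longlonglongrightarrow> 0"
proof -
  have "\<exists>y. fst y \<in> V \<and> snd y \<in> V \<and> \<phi>1 (fst y) + \<phi>2 (snd y) < c \<and>
      norm (fst y - snd y) < inverse (real (Suc n))" for n
  proof -
    have "\<forall>\<^sub>F \<eta> in at_right 0. \<eta> < inverse (real (Suc n)) \<and>
       (INF (x1, x2) \<in> {(x1, x2). x1 \<in> V \<and> x2 \<in> V \<and> norm (x1 - x2) < \<eta>}. \<phi>1 x1 + \<phi>2 x2) < c"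
      using order_tendstoD(2)[OF Lambda_circ_tendsto assms]
        eventually_at_right_real[of 0 "inverse (real (Suc n))"]
      by (auto elim: eventually_elim2)
    then obtain \<eta> where "\<eta> < inverse (real (Suc n))"
       "(INF (x1, x2) \<in> {(x1, x2). x1 \<in> V \<and> x2 \<in> V \<and> norm (x1 - x2) < \<eta>}. \<phi>1 x1 + \<phi>2 x2) < c"
      using eventually_happens trivial_limit_at_right_real by blast
    then show ?thesis unfolding INF_less_iff by fastforce
  qed
  then obtain y where y: "\<And>n. fst (y n) \<in> V \<and> snd (y n) \<in> V \<and> \<phi>1 (fst (y n)) + \<phi>2 (snd (y n)) < c \<and>
      norm (fst (y n) - snd (y n)) < inverse (real (Suc n))"
    by metis
  have "(\<lambda>n. fst (y n) - snd (y n)) \<longlonglongrightarrow> 0"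
    by (rule Lim_null_comparison[OF _ LIMSEQ_inverse_real_of_nat])
      (use y in \<open>auto intro: always_eventually less_imp_le\<close>)
  with y show ?thesis by (intro exI[of _ "\<lambda>n. fst (y n)"] exI[of _ "\<lambda>n. snd (y n)"]) auto
qed

theorem corollary4p14:
  fixes U :: "'a::banach set" and \<phi>1 \<phi>2 :: "'a \<Rightarrow> ereal"
  assumes "reflexive_space TYPE('a)"
    and "convex U" and "bounded U"
    and "\<And>x. \<phi>1 x \<noteq> -\<infinity>" and "\<And>x. \<phi>2 x \<noteq> -\<infinity>"
    and "weakly_seq_lsc_on U \<phi>1" and "weakly_seq_lsc_on U \<phi>2"
    and "edom \<phi>1 \<inter> edom \<phi>2 \<inter> U \<noteq> {}"
  shows "quasiuniformly_lsc_on U \<phi>1 \<phi>2"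
  unfolding quasiuniformly_lsc_on_def Lambda_dagger_def
proof (rule INF_greatest, rule dense_ge)
  fix V c assume V: "V \<in> EI U" and c: "Lambda_circ V \<phi>1 \<phi>2 < c"
  obtain a b where ab: "\<And>n::nat. a n \<in> V" "\<And>n. b n \<in> V" "\<And>n. \<phi>1 (a n) + \<phi>2 (b n) < c"
    and diff: "(\<lambda>n. a n - b n) \<longlonglongrightarrow> 0"
    using Lambda_circ_less_sequences[OF c] by blast
  have hull: "closure (convex hull V) \<subseteq> U"
    using assms(2) V by (rule EI_closure_convex_hull_subset)
  have VU: "V \<subseteq> U"
    using hull hull_subset[of V convex] closure_subset[of "convex hull V"] by blast
  have "bounded (range a)"
    using assms(3) by (rule bounded_subset) (use ab VU in auto)
  then obtain s x where s: "strict_mono (s :: nat \<Rightarrow> nat)" and ax: "weakly_converges (a \<circ> s) x"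
    using reflexive_bounded_weakly_convergent_subseq[OF assms(1)] by blast
  have bx: "weakly_converges (b \<circ> s) x"
    using ax by (rule weakly_converges_shift)
      (use LIMSEQ_subseq_LIMSEQ[OF diff s] in \<open>simp add: o_def\<close>)
  have "x \<in> closure (convex hull V)"
    using weakly_converges_imp_weakly_adherent[OF ax]
    by (rule weakly_adherent_in_closure_convex) (auto intro: hull_inc ab)
  then have x: "x \<in> U" using hull by blast
  have l1: "\<phi>1 x \<le> liminf (\<lambda>n. \<phi>1 (a (s n)))"
    using assms(6)[unfolded weakly_seq_lsc_on_def, rule_format, OF x, of "a \<circ> s"] ax ab(1) VU
    by (auto simp: o_def)
  have l2: "\<phi>2 x \<le> liminf (\<lambda>n. \<phi>2 (b (s n)))"
    using assms(7)[unfolded weakly_seq_lsc_on_def, rule_format, OF x, of "b \<circ> s"] bx ab(2) VU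
    by (auto simp: o_def)
  have "(INF x\<in>U. \<phi>1 x + \<phi>2 x) \<le> \<phi>1 x + \<phi>2 x"
    using x by (rule INF_lower)
  also have "\<dots> \<le> liminf (\<lambda>n. \<phi>1 (a (s n))) + liminf (\<lambda>n. \<phi>2 (b (s n)))"
    using l1 l2 by (rule add_mono)
  \<comment> \<open>Superadditivity of the lower limit fails for \<open>\<infinity> + (-\<infinity>)\<close>; here both lower limits exceed \<open>-\<infinity>\<close>,
    being bounded below by the values at \<open>x\<close>.\<close>
  also have "\<dots> \<le> liminf (\<lambda>n. \<phi>1 (a (s n)) + \<phi>2 (b (s n)))"
    by (rule ereal_liminf_add_mono) (use l1 l2 assms(4,5)[of x] in auto)
  also have "\<dots> \<le> c"
    by (intro Liminf_le) (use ab(3) in \<open>auto intro!: always_eventually less_imp_le\<close>)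
  finally show "(INF x\<in>U. \<phi>1 x + \<phi>2 x) \<le> c" .
qed

end
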